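(* Let $N \ge 1$ be an integer and let $A \in \mathbb{R}^{2N \times 2N}$ be a symplectic matrix, i.e. $A^T J A = J$ where $J = \begin{bmatrix} O & I_N \\ -I_N & O \end{bmatrix}$. Then $\det(A) = 1$.
   Context: $I_N$ denotes the $N \times N$ identity matrix, $O$ the $N \times N$ zero matrix, and $A^T$ the transpose of $A$. The set of $2N\times 2N$ symplectic matrices over a field $\mathbb{K}$, i.e. matrices $A \in \mathbb{K}^{2N\times 2N}$ with $A^T J A = J$, is denoted $Sp(2N,\mathbb{K})$; here $\mathbb{K} = \mathbb{R}$. *)

theory Defs
  imports Jordan_Normal_Form.Determinant
begin

definition symplectic_form :: "nat \<Rightarrow> 'a :: field mat" where
  "symplectic_form N = four_block_mat (0\<^sub>m N N) (1\<^sub>m N) (- 1\<^sub>m N) (0\<^sub>m N N)"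

definition Sp :: "nat \<Rightarrow> 'a :: field mat set" where
  \<comment> \<open>The parameter is the half-dimension: \<open>Sp N\<close> is the set written $Sp(2N, K)$,
    with the field $K$ given by the type \<open>'a\<close>.\<close>
  "Sp N = {A \<in> carrier_mat (2 * N) (2 * N).
    transpose_mat A * symplectic_form N * A = symplectic_form N}"

end

theory Submission
  imports Defs "Jordan_Normal_Form.Char_Poly"
begin

text \<open>Since \<open>A\<^sup>T (J A J\<^sup>T) = J J\<^sup>T = I\<close>, the determinant squares to 1 and
  \<open>A\<^sup>T A + I = A\<^sup>T (A + J A J\<^sup>T)\<close>. The left-hand side is positive definite, so its determinant
  is positive; on the right, \<open>A + J A J\<^sup>T\<close> has the block form \<open>[[C, D], [-D, C]]\<close>, whose
  determinant is \<open>\<bar>det (C + iD)\<bar>\<^sup>2 \<ge> 0\<close>. Hence \<open>det A\<close> is positive.\<close>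

text \<open>\<open>M\<close> need not be symmetric, so the argument avoids diagonalization: the
  characteristic polynomial of \<open>- M\<close> is monic and has no root in [0, \<infinity>),
  hence is positive at 0, where its value is \<open>det M\<close>.\<close>

lemma det_pos_of_quadratic_form_pos:
  fixes M :: "real mat"
  assumes M: "M \<in> carrier_mat n n"
    and pos: "\<And>v. v \<in> carrier_vec n \<Longrightarrow> v \<noteq> 0\<^sub>v n \<Longrightarrow> v \<bullet> (M *\<^sub>v v) > 0"
  shows "det M > 0"
proof -
  let ?p = "char_poly (- M)"
  have M': "- M \<in> carrier_mat n n" using M by simp
  have no_root: "poly ?p k \<noteq> 0" if "k \<ge> 0" for k
  proof
    assume "poly ?p k = 0"
    then obtain v where v: "v \<in> carrier_vec n" "v \<noteq> 0\<^sub>v n" and ev: "- M *\<^sub>v v = k \<cdot>\<^sub>v v"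
      using eigenvalue_root_char_poly[OF M', of k] M
      unfolding eigenvalue_def eigenvector_def by auto
    \<comment> \<open>A root \<open>k\<close> \<ge> 0 is an eigenvalue of \<open>- M\<close>, and
      its eigenvector would make the quadratic form of \<open>M\<close> nonpositive.\<close>
    have "- (v \<bullet> (M *\<^sub>v v)) = v \<bullet> (- M *\<^sub>v v)"
      using M v by (simp add: uminus_mult_mat_vec)
    also have "\<dots> = k * (v \<bullet> v)" using v ev by simp
    also have "\<dots> \<ge> 0"
      using \<open>k \<ge> 0\<close> conjugate_square_ge_0_vec[of v] by simp
    finally show False using pos[OF v] by simp
  qed
  have "lead_coeff ?p = 1" using degree_monic_char_poly[OF M'] by simp
  then obtain b where b: "\<And>x. x \<ge> b \<Longrightarrow> poly ?p x \<ge> 1"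
    using poly_pinfty_gt_lc[of ?p] by auto
  have "poly ?p 0 > 0"
  proof (rule ccontr)
    assume "\<not> poly ?p 0 > 0"
    then have neg: "poly ?p 0 < 0" using no_root[of 0] by simp
    \<comment> \<open>Taking the maximum with 1 keeps the endpoint to the right of 0, so the
      intermediate value theorem yields a positive root.\<close>
    have "poly ?p (max b 1) > 0" using b[of "max b 1"] by simp
    from poly_IVT_pos[OF _ neg this] no_root show False by fastforce
  qed
  moreover have "- char_matrix (- M) 0 = M"
    using M unfolding char_matrix_def by (intro eq_matI) auto
  ultimately show ?thesis using char_poly_matrix[OF M', of 0] by simp
qed

text \<open>The quadratic form at \<open>v\<close> is |Av|^2 + |v|^2, which is positive for nonzero
  \<open>v\<close>.\<close>

lemma det_transpose_mult_self_plus_one_pos: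
  fixes A :: "real mat"
  assumes A: "A \<in> carrier_mat m n"
  shows "det (transpose_mat A * A + 1\<^sub>m n) > 0"
proof (rule det_pos_of_quadratic_form_pos[of _ n])
  fix v :: "real vec"
  assume v: "v \<in> carrier_vec n" "v \<noteq> 0\<^sub>v n"
  have "(transpose_mat A * A + 1\<^sub>m n) *\<^sub>v v = transpose_mat A *\<^sub>v (A *\<^sub>v v) + v"
    using A v by (simp add: add_mult_distrib_mat_vec[of _ n n])
  moreover have "v \<bullet> (transpose_mat A *\<^sub>v (A *\<^sub>v v)) = (A *\<^sub>v v) \<bullet> (A *\<^sub>v v)"
    using A v transpose_vec_mult_scalar[OF A v(1), of "A *\<^sub>v v"]
    by (simp add: comm_scalar_prod[of v n])
  moreover have "(A *\<^sub>v v) \<bullet> (A *\<^sub>v v) \<ge> 0"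
    using conjugate_square_ge_0_vec[of "A *\<^sub>v v"] by simp
  moreover have "v \<bullet> v > 0"
    using conjugate_square_greater_0_vec[OF v(1)] v by simp
  ultimately show "v \<bullet> ((transpose_mat A * A + 1\<^sub>m n) *\<^sub>v v) > 0"
    using A v by (simp add: scalar_prod_add_distrib[of _ n])
qed (use A in auto)

text \<open>Conjugation by a unipotent block matrix makes the left-hand matrix block upper
  triangular, with the two factors on the diagonal.\<close>

lemma det_four_block_complex_structure:
  fixes C D :: "complex mat"
  assumes C: "C \<in> carrier_mat n n" and D: "D \<in> carrier_mat n n"
  shows "det (four_block_mat C D (- D) C) = det (C + \<i> \<cdot>\<^sub>m D) * det (C - \<i> \<cdot>\<^sub>m D)"
proof -
  let ?M = "four_block_mat C D (- D) C"
  \<comment> \<open>On the right, \<open>L z\<close> adds \<open>z\<close> times the second block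
    column to the first; on the left, it adds \<open>z\<close> times the first block row to the
    second. \<open>L (- \<i>)\<close> is the inverse of \<open>L \<i>\<close>.\<close>
  define L :: "complex \<Rightarrow> complex mat"
    where "L z = four_block_mat (1\<^sub>m n) (0\<^sub>m n n) (z \<cdot>\<^sub>m 1\<^sub>m n) (1\<^sub>m n)" for z
  have L: "L z \<in> carrier_mat (n + n) (n + n)" for z
    unfolding L_def by (rule four_block_carrier_mat) auto
  have M: "?M \<in> carrier_mat (n + n) (n + n)"
    using C D by (intro four_block_carrier_mat) auto
  have det_L: "det (L z) = 1" for z
    unfolding L_def by (subst det_four_block_mat_upper_right_zero[of _ n _ n]) auto
  have "?M * L \<i> = four_block_mat (C + \<i> \<cdot>\<^sub>m D) D (- D + \<i> \<cdot>\<^sub>m C) C"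
    unfolding L_def using C D
    by (subst mult_four_block_mat[of _ n n _ n _ n _ _ n _ n])
      (auto simp: mult_smult_distrib[of _ n n])
  then have "L (- \<i>) * (?M * L \<i>) = L (- \<i>) * four_block_mat (C + \<i> \<cdot>\<^sub>m D) D (- D + \<i> \<cdot>\<^sub>m C) C"
    by simp
  also have "\<dots> = four_block_mat (C + \<i> \<cdot>\<^sub>m D) D
      (- \<i> \<cdot>\<^sub>m (C + \<i> \<cdot>\<^sub>m D) + (- D + \<i> \<cdot>\<^sub>m C)) (- \<i> \<cdot>\<^sub>m D + C)"
    unfolding L_def using C D
    by (subst mult_four_block_mat[of _ n n _ n _ n _ _ n _ n])
      (auto simp: mult_smult_assoc_mat[of _ n n])
  also have "- \<i> \<cdot>\<^sub>m (C + \<i> \<cdot>\<^sub>m D) + (- D + \<i> \<cdot>\<^sub>m C) = 0\<^sub>m n n"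
    using C D by (intro eq_matI) (auto simp: algebra_simps)
  also have "- \<i> \<cdot>\<^sub>m D + C = C - \<i> \<cdot>\<^sub>m D"
    using C D by (intro eq_matI) auto
  finally have "det (L (- \<i>) * (?M * L \<i>))
      = det (four_block_mat (C + \<i> \<cdot>\<^sub>m D) D (0\<^sub>m n n) (C - \<i> \<cdot>\<^sub>m D))"
    by simp
  also have "\<dots> = det (C + \<i> \<cdot>\<^sub>m D) * det (C - \<i> \<cdot>\<^sub>m D)"
    using C D by (intro det_four_block_mat_lower_left_zero) auto
  also have "det (L (- \<i>) * (?M * L \<i>)) = det ?M"
    using L M by (simp add: det_mult[of _ "n + n"] det_L)
  finally show ?thesis .
qed

text \<open>For real blocks the two complex factors are conjugate to each other, so their product is
  a squared modulus.\<close>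

lemma det_four_block_complex_structure_nonneg:
  fixes C D :: "real mat"
  assumes C: "C \<in> carrier_mat n n" and D: "D \<in> carrier_mat n n"
  shows "det (four_block_mat C D (- D) C) \<ge> 0"
proof -
  \<comment> \<open>As a ring homomorphism, \<open>cnj\<close> commutes with
    \<open>det\<close>.\<close>
  interpret cnj: comm_ring_hom cnj by unfold_locales auto
  let ?c = "map_mat complex_of_real"
  let ?z = "det (?c C + \<i> \<cdot>\<^sub>m ?c D)"
  have "complex_of_real (det (four_block_mat C D (- D) C))
      = det (?c (four_block_mat C D (- D) C))"
    by simp
  also have "?c (four_block_mat C D (- D) C) = four_block_mat (?c C) (?c D) (- ?c D) (?c C)"
    using C D by (intro eq_matI) auto
  also have "det \<dots> = ?z * det (?c C - \<i> \<cdot>\<^sub>m ?c D)"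
    using C D by (intro det_four_block_complex_structure) auto
  also have "?c C - \<i> \<cdot>\<^sub>m ?c D = map_mat cnj (?c C + \<i> \<cdot>\<^sub>m ?c D)"
    using C D by (intro eq_matI) auto
  also have "?z * det \<dots> = complex_of_real ((cmod ?z)\<^sup>2)"
    by (simp add: complex_norm_square del: of_real_power)
  finally have "det (four_block_mat C D (- D) C) = (cmod ?z)\<^sup>2"
    by (simp only: of_real_eq_iff)
  then show ?thesis by simp
qed

lemma symplectic_form_carrier: "symplectic_form N \<in> carrier_mat (N + N) (N + N)"
  unfolding symplectic_form_def by (rule four_block_carrier_mat) auto

lemma transpose_symplectic_form:
  "transpose_mat (symplectic_form N) = four_block_mat (0\<^sub>m N N) (- 1\<^sub>m N) (1\<^sub>m N) (0\<^sub>m N N)"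
  unfolding symplectic_form_def
  by (subst transpose_four_block_mat[of _ N N _ N _ N]) (auto simp: transpose_uminus)

lemma symplectic_form_mult_transpose:
  "symplectic_form N * transpose_mat (symplectic_form N) = 1\<^sub>m (N + N)"
  unfolding transpose_symplectic_form unfolding symplectic_form_def
  by (subst mult_four_block_mat[of _ N N _ N _ N _ _ N _ N]) (auto intro!: eq_matI)

lemma symplectic_form_conjugate_four_block:
  assumes "P \<in> carrier_mat N N" "Q \<in> carrier_mat N N" "R \<in> carrier_mat N N" "S \<in> carrier_mat N N"
  shows "symplectic_form N * four_block_mat P Q R S * transpose_mat (symplectic_form N)
    = four_block_mat S (- R) (- Q) P"
proof -
  have "symplectic_form N * four_block_mat P Q R S = four_block_mat R S (- P) (- Q)"
    unfolding symplectic_form_def using assms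
    by (subst mult_four_block_mat[of _ N N _ N _ N _ _ N _ N]) auto
  then show ?thesis
    unfolding transpose_symplectic_form using assms
    by (simp add: mult_four_block_mat[of _ N N _ N _ N _ _ N _ N])
qed

text \<open>Conjugation by J swaps the diagonal blocks, and swaps and negates the off-diagonal ones.
  Adding the result to \<open>A\<close> therefore leaves equal diagonal blocks and opposite
  off-diagonal blocks.\<close>

lemma det_add_symplectic_conjugate_nonneg:
  fixes A :: "real mat"
  assumes A: "A \<in> carrier_mat (N + N) (N + N)"
  shows "det (A + symplectic_form N * A * transpose_mat (symplectic_form N)) \<ge> 0"
proof -
  obtain P Q R S where sp: "split_block A N N = (P, Q, R, S)"
    by (cases "split_block A N N") auto
  note b = split_block[OF sp, of N N]
  have c: "P \<in> carrier_mat N N" "Q \<in> carrier_mat N N" "R \<in> carrier_mat N N" "S \<in> carrier_mat N N"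
    and eq: "A = four_block_mat P Q R S"
    using b A by auto
  have "A + symplectic_form N * A * transpose_mat (symplectic_form N)
      = four_block_mat (P + S) (Q - R) (- (Q - R)) (P + S)"
    unfolding eq symplectic_form_conjugate_four_block[OF c]
    using c by (intro eq_matI) auto
  then show ?thesis
    using det_four_block_complex_structure_nonneg[of "P + S" N "Q - R"] c
    by (simp add: minus_carrier_mat)
qed

theorem theorem2p1:
  fixes N :: nat and A :: "real mat"
  assumes "N \<ge> 1"
    and "A \<in> Sp N"
  shows "det A = 1"
proof -
  let ?J = "symplectic_form N :: real mat"
  let ?B = "?J * A * transpose_mat ?J"
  have A: "A \<in> carrier_mat (N + N) (N + N)" and AJA: "transpose_mat A * ?J * A = ?J"
    using assms(2) unfolding Sp_def by (auto simp: mult_2)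
  have J: "?J \<in> carrier_mat (N + N) (N + N)" by (rule symplectic_form_carrier)
  have B: "?B \<in> carrier_mat (N + N) (N + N)" using A J by simp
  have "transpose_mat A * ?B = transpose_mat A * ?J * A * transpose_mat ?J"
    using A J by (simp add: assoc_mult_mat[of _ "N + N" "N + N" _ "N + N" _ "N + N"])
  then have inv: "transpose_mat A * ?B = 1\<^sub>m (N + N)"
    by (simp add: AJA symplectic_form_mult_transpose)
  \<comment> \<open>Only the square of \<open>det ?J\<close> enters, so its sign is never
    computed.\<close>
  have "det ?J * det ?J = 1"
    using arg_cong[OF symplectic_form_mult_transpose[of N], of "det :: real mat \<Rightarrow> real"] J
    by (simp add: det_mult[of _ "N + N"] det_transpose[of _ "N + N"])
  moreover have "det A * (det ?J * det A * det ?J) = 1"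
    using arg_cong[OF inv, of det] A J
    by (simp add: det_mult[of _ "N + N"] det_transpose[of _ "N + N"])
  ultimately have sq: "det A * det A = 1"
    by (metis mult.assoc mult.commute mult.right_neutral)
  have "transpose_mat A * (A + ?B) = transpose_mat A * A + 1\<^sub>m (N + N)"
    using A B by (simp add: mult_add_distrib_mat[of _ "N + N" "N + N"] inv)
  then have "det A * det (A + ?B) > 0"
    using det_transpose_mult_self_plus_one_pos[OF A] A B
    by (metis add_carrier_mat det_mult det_transpose transpose_carrier_mat)
  \<comment> \<open>A positive product whose second factor is nonnegative has a positive first
    factor; this excludes \<open>det A = -1\<close>.\<close>
  with det_add_symplectic_conjugate_nonneg[OF A] have "det A > 0"
    by (simp add: zero_less_mult_iff)
  with sq show ?thesis
    by (metis abs_of_pos mult_1 real_sqrt_abs2 real_sqrt_one)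
qed

end
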